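(* Let $\psi_\alpha(s_\alpha)$ and $\psi_\beta(s_\beta)$ be two regular curves in Euclidean 3-space $\mathbf{E}^3$, parameterized by arclengths $s_\alpha$ and $s_\beta$, with curvatures $\kappa_\alpha,\kappa_\beta$ and torsions $\tau_\alpha,\tau_\beta$. Then $\psi_\alpha$ and $\psi_\beta$ are two similar curves with variable transformation if and only if the ratios of torsion and curvature are the same for the curves, $$\frac{\tau_\beta(s_\beta)}{\kappa_\beta(s_\beta)}=\frac{\tau_\alpha(s_\alpha)}{\kappa_\alpha(s_\alpha)},$$ under the particular variable transformation of the arclengths $\lambda^\beta_\alpha=\frac{ds_\beta}{ds_\alpha}=\frac{\kappa_\alpha}{\kappa_\beta}$ keeping equal total curvatures, i.e., $$\theta_\beta(s_\beta)=\int\kappa_\beta\,ds_\beta=\int\kappa_\alpha\,ds_\alpha=\theta_\alpha(s_\alpha).$$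
   Context: Curves are in Euclidean 3-space $\mathbf{E}^3$ with the usual metric. Let $\psi_\alpha(s_\alpha)$ and $\psi_\beta(s_\beta)$ be two regular curves parameterized by arclengths $s_\alpha$ and $s_\beta$, with curvatures $\kappa_\alpha,\kappa_\beta$, torsions $\tau_\alpha,\tau_\beta$ and Frenet frames $\{\mathbf{T}_\alpha,\mathbf{N}_\alpha,\mathbf{B}_\alpha\}$ and $\{\mathbf{T}_\beta,\mathbf{N}_\beta,\mathbf{B}_\beta\}$ (unit tangent, principal normal, binormal), satisfying the Frenet equations $\mathbf{T}'=\kappa\mathbf{N}$, $\mathbf{N}'=-\kappa\mathbf{T}+\tau\mathbf{B}$, $\mathbf{B}'=-\tau\mathbf{N}$. They are called similar curves with variable transformation $\lambda^\alpha_\beta$ if there exists a variable transformation $s_\alpha=\int\lambda^\alpha_\beta(s_\beta)\,ds_\beta$ of the arclengths, with $\lambda^\alpha_\beta$ an arbitrary function of the arclength, such that the tangent vectors are the same, $\mathbf{T}_\beta(s_\beta)=\mathbf{T}_\alpha(s_\alpha)$, for all corresponding values of the parameters under the transformation. Thus $\lambda^\alpha_\beta=\frac{ds_\alpha}{ds_\beta}$, $\lambda^\beta_\alpha=\frac{ds_\beta}{ds_\alpha}$ and $\lambda^\alpha_\beta\lambda^\beta_\alpha=1$. Equality of quantities of the two curves "under" a variable transformation means equality for all values of $s_\alpha,s_\beta$ that correspond under that transformation.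
   Formalization: Equal ratios give similarity only after a rigid motion of one curve (circles in non-parallel planes refute the literal claim), and the variable transformation is required to have positive derivative (a negative one flips the sign of torsion/curvature, as for helices). *)

theory Defs
  imports "HOL-Analysis.Analysis"
begin

section \<open>Frenet apparatus of arclength-parameterized curves\<close>

text \<open>The formulas below are those of a curve parameterized by arclength; they are
  meaningful for the curves singled out by \<open>frenet_curve\<close> below.\<close>

definition tangent :: "(real \<Rightarrow> real^3) \<Rightarrow> real \<Rightarrow> real^3" where
  "tangent \<psi> s = vector_derivative \<psi> (at s)"

definition curvature :: "(real \<Rightarrow> real^3) \<Rightarrow> real \<Rightarrow> real" where
  "curvature \<psi> s = norm (vector_derivative (tangent \<psi>) (at s))"

definition principal_normal :: "(real \<Rightarrow> real^3) \<Rightarrow> real \<Rightarrow> real^3" where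
  "principal_normal \<psi> s = vector_derivative (tangent \<psi>) (at s) /\<^sub>R curvature \<psi> s"

definition binormal :: "(real \<Rightarrow> real^3) \<Rightarrow> real \<Rightarrow> real^3" where
  "binormal \<psi> s = cross3 (tangent \<psi> s) (principal_normal \<psi> s)"

text \<open>The sign is the one of the Frenet equation \<open>B' = - \<tau> N\<close>.\<close>

definition torsion :: "(real \<Rightarrow> real^3) \<Rightarrow> real \<Rightarrow> real" where
  "torsion \<psi> s = - (vector_derivative (binormal \<psi>) (at s) \<bullet> principal_normal \<psi> s)"

text \<open>Three derivatives are exactly what the Frenet equations need, so this covers curves of
  class \<open>C\<^sup>3\<close> and smooth curves. Unit speed makes the curve regular and its parameter an
  arclength. The curvature must not vanish, since otherwise the principal normal (and the ratio
  \<open>\<tau> / \<kappa>\<close>) is undefined.\<close>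

definition frenet_curve :: "real set \<Rightarrow> (real \<Rightarrow> real^3) \<Rightarrow> bool" where
  "frenet_curve I \<psi> \<longleftrightarrow>
     open I \<and> is_interval I \<and> I \<noteq> {} \<and>
     (\<forall>s\<in>I. \<psi> differentiable (at s)) \<and>
     (\<forall>s\<in>I. tangent \<psi> differentiable (at s)) \<and>
     (\<forall>s\<in>I. (\<lambda>u. vector_derivative (tangent \<psi>) (at u)) differentiable (at s)) \<and>
     (\<forall>s\<in>I. norm (tangent \<psi> s) = 1) \<and>
     (\<forall>s\<in>I. curvature \<psi> s \<noteq> 0)"

text \<open>Total curvature accumulated from the base point \<open>a\<close>; the integral is oriented, so it is
  negative for \<open>s < a\<close>.\<close>

definition total_curvature :: "(real \<Rightarrow> real^3) \<Rightarrow> real \<Rightarrow> real \<Rightarrow> real" where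
  "total_curvature \<psi> a s = (LBINT u=ereal a..ereal s. curvature \<psi> u)"


section \<open>Similar curves with variable transformation\<close>

text \<open>\<open>variable_transformation J I \<phi> lam\<close>: the map \<open>s = \<phi> t\<close> is a variable transformation from
  the arclength \<open>t \<in> J\<close> onto the arclength \<open>s \<in> I\<close> with \<open>ds/dt = lam t\<close>, i.e. \<open>\<phi>\<close> is an
  indefinite integral of \<open>lam\<close>. It preserves the orientation of the curves: \<open>lam\<close> is positive.
  (A reversal \<open>lam < 0\<close> would turn \<open>N\<close> into \<open>- N\<close> and change the sign of \<open>\<tau> / \<kappa>\<close>.)\<close>

definition variable_transformation ::
  "real set \<Rightarrow> real set \<Rightarrow> (real \<Rightarrow> real) \<Rightarrow> (real \<Rightarrow> real) \<Rightarrow> bool" where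
  "variable_transformation J I \<phi> lam \<longleftrightarrow>
     bij_betw \<phi> J I \<and>
     (\<forall>t\<in>J. lam t > 0 \<and> (\<phi> has_real_derivative lam t) (at t))"

text \<open>Here \<open>lam\<close>, a function of the arclength of \<open>\<beta>\<close>, is \<open>ds\<^sub>\<alpha> / ds\<^sub>\<beta>\<close>.\<close>

definition similar_curves_with ::
  "(real \<Rightarrow> real) \<Rightarrow> real set \<Rightarrow> (real \<Rightarrow> real^3) \<Rightarrow> real set \<Rightarrow> (real \<Rightarrow> real^3) \<Rightarrow> bool" where
  "similar_curves_with lam I \<alpha> J \<beta> \<longleftrightarrow>
     (\<exists>\<phi>. variable_transformation J I \<phi> lam \<and> (\<forall>t\<in>J. tangent \<beta> t = tangent \<alpha> (\<phi> t)))"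

definition similar_curves ::
  "real set \<Rightarrow> (real \<Rightarrow> real^3) \<Rightarrow> real set \<Rightarrow> (real \<Rightarrow> real^3) \<Rightarrow> bool" where
  "similar_curves I \<alpha> J \<beta> \<longleftrightarrow> (\<exists>lam. similar_curves_with lam I \<alpha> J \<beta>)"

text \<open>The transformation \<open>s\<^sub>\<beta> = \<sigma> s\<^sub>\<alpha>\<close> has derivative \<open>ds\<^sub>\<beta> / ds\<^sub>\<alpha> = \<kappa>\<^sub>\<alpha> / \<kappa>\<^sub>\<beta>\<close> at
  corresponding parameters. The base points \<open>a\<close>, \<open>b\<close> are the integration constants of the two
  indefinite integrals \<open>\<theta>\<^sub>\<alpha>\<close> and \<open>\<theta>\<^sub>\<beta>\<close>.\<close>

definition equal_ratio_under_equal_total_curvature ::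
  "real set \<Rightarrow> (real \<Rightarrow> real^3) \<Rightarrow> real set \<Rightarrow> (real \<Rightarrow> real^3) \<Rightarrow> bool" where
  "equal_ratio_under_equal_total_curvature I \<alpha> J \<beta> \<longleftrightarrow>
     (\<exists>\<sigma>. variable_transformation I J \<sigma> (\<lambda>s. curvature \<alpha> s / curvature \<beta> (\<sigma> s)) \<and>
          (\<exists>a\<in>I. \<exists>b\<in>J. \<forall>s\<in>I. total_curvature \<beta> b (\<sigma> s) = total_curvature \<alpha> a s) \<and>
          (\<forall>s\<in>I. torsion \<beta> (\<sigma> s) / curvature \<beta> (\<sigma> s) = torsion \<alpha> s / curvature \<alpha> s))"


section \<open>Position in space\<close>

text \<open>Orientation-preserving isometries of Euclidean 3-space. Curvature and torsion determine a
  curve only up to such a motion, whereas similarity compares tangent vectors in a fixed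
  position.\<close>

definition rigid_motion :: "(real^3 \<Rightarrow> real^3) \<Rightarrow> bool" where
  "rigid_motion g \<longleftrightarrow> (\<exists>Q c. rotation_matrix Q \<and> g = (\<lambda>x. Q *v x + c))"

end

theory Submission
  imports Defs
begin

text \<open>
  Differentiating \<open>Q T\<^sub>\<beta>(t) = T\<^sub>\<alpha>(\<phi>(t))\<close>, with \<open>Q\<close> a fixed rotation, gives
  \<open>\<kappa>\<^sub>\<beta> Q N\<^sub>\<beta> = \<phi>' \<kappa>\<^sub>\<alpha> N\<^sub>\<alpha>\<close>. Since \<open>\<phi>' > 0\<close>, comparing norms and directions yields
  \<open>\<kappa>\<^sub>\<beta> = \<phi>' \<kappa>\<^sub>\<alpha>\<close> and \<open>Q N\<^sub>\<beta> = N\<^sub>\<alpha>\<close>; rotations respect cross products, so also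
  \<open>Q B\<^sub>\<beta> = B\<^sub>\<alpha>\<close>, and one more differentiation yields \<open>\<tau>\<^sub>\<beta> = \<phi>' \<tau>\<^sub>\<alpha>\<close>. Curvature and torsion thus
  scale by the same factor, and the inverse transformation \<open>\<sigma> = \<phi>\<inverse>\<close> has derivative
  \<open>\<kappa>\<^sub>\<alpha> / \<kappa>\<^sub>\<beta>\<close>, which by substitution means equal total curvatures
  (\<open>equal_ratio_of_equal_tangents\<close>). A rigid motion acts on tangents only through its rotation
  \<open>Q\<close>, so this one computation handles both similarity in place, \<open>Q = 1\<close>, and similarity after a
  motion.

  Conversely, parameterize both frames by the arclength \<open>s\<close> of \<open>\<alpha>\<close>. When the ratios
  \<open>\<rho> = \<tau> / \<kappa>\<close> agree and \<open>\<sigma>' = \<kappa>\<^sub>\<alpha> / \<kappa>\<^sub>\<beta>\<close>, both frames solve the same linear system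
  \<open>T' = \<kappa>\<^sub>\<alpha> N\<close>, \<open>N' = \<kappa>\<^sub>\<alpha> (- T + \<rho> B)\<close>, \<open>B' = - \<kappa>\<^sub>\<alpha> \<rho> N\<close>. Its matrix is skew, so the
  rotation \<open>M(s)\<close> that carries the frame of \<open>\<beta>\<close> at \<open>\<sigma>(s)\<close> to the frame of \<open>\<alpha>\<close> at \<open>s\<close> has
  derivative zero. Hence it is one rotation for all \<open>s\<close>, and applying it to \<open>\<beta>\<close> makes the tangents
  agree (\<open>rotation_of_equal_ratio\<close>).
\<close>

section \<open>Right-handed orthonormal frames\<close>

definition right_handed_frame :: "real^3 \<Rightarrow> real^3 \<Rightarrow> real^3 \<Rightarrow> bool" where
  "right_handed_frame u v w \<longleftrightarrow> u \<bullet> u = 1 \<and> v \<bullet> v = 1 \<and> u \<bullet> v = 0 \<and> w = cross3 u v"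

lemma right_handed_frame_inner:
  assumes "right_handed_frame u v w"
  shows "u \<bullet> u = 1" "v \<bullet> v = 1" "w \<bullet> w = 1" "u \<bullet> v = 0" "u \<bullet> w = 0" "v \<bullet> w = 0"
    "v \<bullet> u = 0" "w \<bullet> u = 0" "w \<bullet> v = 0"
proof -
  show "w \<bullet> w = 1"
    using norm_cross_dot[of u v] assms
    by (simp only: right_handed_frame_def power2_norm_eq_inner power_mult_distrib) simp
qed (use assms in \<open>auto simp: right_handed_frame_def dot_cross_self inner_commute\<close>)

lemma rotation_matrix_frame:
  assumes "right_handed_frame u v w"
  shows "rotation_matrix (vector [u, v, w] :: real^3^3)"
proof -
  note f = right_handed_frame_inner[OF assms]
  have "orthogonal_matrix (vector [u, v, w] :: real^3^3)"
    unfolding orthogonal_matrix_orthonormal_rows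
    by (auto simp: forall_3 row_def vec_lambda_eta norm_eq_1 orthogonal_def f)
  moreover have "det (vector [u, v, w] :: real^3^3) = w \<bullet> w"
    using assms by (simp add: right_handed_frame_def cross3_simps)
  ultimately show ?thesis
    by (simp add: rotation_matrix_def f)
qed

text \<open>For right-handed frames this matrix is the rotation taking \<open>u', v', w'\<close> to \<open>u, v, w\<close>. In the
  expanded form it can be differentiated by the product rule.\<close>

lemma frame_to_frame_matrix_vector_mult:
  fixes u v w u' v' w' x :: "real^3"
  shows "(transpose (vector [u, v, w] :: real^3^3) ** vector [u', v', w']) *v x =
    (u' \<bullet> x) *\<^sub>R u + (v' \<bullet> x) *\<^sub>R v + (w' \<bullet> x) *\<^sub>R w"
  unfolding matrix_vector_mul_assoc[symmetric]
  by (simp add: vec_eq_iff matrix_vector_mult_def transpose_def sum_3 inner_vec_def forall_3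
      mult.commute del: transpose_matrix_vector)

text \<open>The matrix that carries the frame to itself is the identity.\<close>

lemma frame_expansion:
  assumes "right_handed_frame u v w"
  shows "x = (u \<bullet> x) *\<^sub>R u + (v \<bullet> x) *\<^sub>R v + (w \<bullet> x) *\<^sub>R w"
  using rotation_matrix_frame[OF assms] frame_to_frame_matrix_vector_mult[of u v w u v w x]
  unfolding rotation_matrix_def orthogonal_matrix_def by (metis matrix_vector_mul_lid)

lemma rotation_matrix_transpose_mult:
  fixes A B :: "real^'n^'n"
  assumes "rotation_matrix A" "rotation_matrix B"
  shows "rotation_matrix (transpose A ** B)"
  using assms
  by (simp add: rotation_matrix_def orthogonal_matrix_mul orthogonal_matrix_transpose det_mul)

lemma rotation_matrix_norm:
  fixes Q :: "real^'n^'n"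
  assumes "rotation_matrix Q"
  shows "norm (Q *v x) = norm x"
proof -
  have "transpose Q *v (Q *v x) = x"
    using assms
    by (simp add: rotation_matrix_def orthogonal_matrix_def matrix_vector_mul_assoc
        del: transpose_matrix_vector)
  then have "(Q *v x) \<bullet> (Q *v x) = x \<bullet> x"
    by (metis dot_lmul_matrix transpose_matrix_vector inner_commute)
  then show ?thesis by (simp add: norm_eq)
qed

section \<open>The Frenet equations\<close>

lemma has_vector_derivative_inner:
  fixes f g :: "real \<Rightarrow> 'a::real_inner"
  assumes "(f has_vector_derivative f') (at s)" "(g has_vector_derivative g') (at s)"
  shows "((\<lambda>u. f u \<bullet> g u) has_real_derivative f' \<bullet> g s + f s \<bullet> g') (at s)"
  using bounded_bilinear.has_vector_derivative[OF bounded_bilinear_inner assms]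
  by (simp add: has_real_derivative_iff_has_vector_derivative add.commute)

lemma has_vector_derivative_cross3:
  assumes "(f has_vector_derivative f') (at s)" "(g has_vector_derivative g') (at s)"
  shows "((\<lambda>u. cross3 (f u) (g u)) has_vector_derivative
    cross3 f' (g s) + cross3 (f s) g') (at s)"
  using bounded_bilinear.has_vector_derivative
    [OF bilinear_conv_bounded_bilinear[THEN iffD1, OF bilinear_cross] assms]
  by (simp add: add.commute)

text \<open>Applied to the constant inner products of a moving orthonormal frame, this says that its
  coefficient matrix is skew. Skewness determines the remaining Frenet coefficients from
  \<open>T' = \<kappa> N\<close> and the definition of \<open>\<tau>\<close>.\<close>

lemma derivative_of_constant_inner:
  fixes f g :: "real \<Rightarrow> 'a::real_inner"
  assumes "open S" "s \<in> S" "\<And>u. u \<in> S \<Longrightarrow> f u \<bullet> g u = c"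
    and "(f has_vector_derivative f') (at s)" "(g has_vector_derivative g') (at s)"
  shows "f' \<bullet> g s + f s \<bullet> g' = 0"
proof -
  have "((\<lambda>u. c) has_real_derivative f' \<bullet> g s + f s \<bullet> g') (at s)"
    by (rule has_field_derivative_transform_within_open[OF
          has_vector_derivative_inner[OF assms(4,5)] assms(1,2)]) (rule assms(3))
  from DERIV_unique[OF this DERIV_const] show ?thesis .
qed

context
  fixes I :: "real set" and \<psi> :: "real \<Rightarrow> real^3"
  assumes curve: "frenet_curve I \<psi>"
begin

lemma curvature_pos: "s \<in> I \<Longrightarrow> curvature \<psi> s > 0"
  using curve by (auto simp: frenet_curve_def curvature_def)

lemma tangent_derivative:
  assumes "s \<in> I"
  shows "(tangent \<psi> has_vector_derivative curvature \<psi> s *\<^sub>R principal_normal \<psi> s) (at s)"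
proof -
  have "tangent \<psi> differentiable (at s)"
    using curve assms by (simp add: frenet_curve_def)
  then show ?thesis
    using curvature_pos[OF assms] by (simp add: principal_normal_def vector_derivative_works)
qed

lemma curvature_differentiable:
  assumes "s \<in> I"
  shows "curvature \<psi> differentiable (at s)"
proof -
  let ?T' = "\<lambda>u. vector_derivative (tangent \<psi>) (at u)"
  have "?T' differentiable (at s)" "?T' s \<noteq> 0"
    using curve curvature_pos[OF assms] assms by (auto simp: frenet_curve_def curvature_def)
  then have "(norm \<circ> ?T') differentiable (at s)"
    by (intro differentiable_chain_at differentiable_norm_at)
  moreover have "norm \<circ> ?T' = curvature \<psi>"
    by (auto simp: curvature_def)
  ultimately show ?thesis by simp
qed

lemma curvature_continuous: "continuous_on I (curvature \<psi>)"
  by (meson continuous_at_imp_continuous_on curvature_differentiable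
      differentiable_imp_continuous_within)

lemma principal_normal_differentiable:
  assumes "s \<in> I"
  shows "principal_normal \<psi> differentiable (at s)"
proof -
  have "principal_normal \<psi> =
      (\<lambda>u. inverse (curvature \<psi> u) *\<^sub>R vector_derivative (tangent \<psi>) (at u))"
    by (auto simp: principal_normal_def)
  moreover have "(\<lambda>u. vector_derivative (tangent \<psi>) (at u)) differentiable (at s)"
    using curve assms by (simp add: frenet_curve_def)
  ultimately show ?thesis
    using curvature_differentiable[OF assms] curvature_pos[OF assms]
    by (auto intro!: differentiable_scaleR differentiable_inverse)
qed

lemma frenet_frame:
  assumes "s \<in> I"
  shows "right_handed_frame (tangent \<psi> s) (principal_normal \<psi> s) (binormal \<psi> s)"
proof -
  have open_I: "open I" and unit: "\<And>u. u \<in> I \<Longrightarrow> tangent \<psi> u \<bullet> tangent \<psi> u = 1"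
    using curve by (auto simp: frenet_curve_def norm_eq_1)
  have "tangent \<psi> s \<bullet> principal_normal \<psi> s = 0"
    using derivative_of_constant_inner[OF open_I assms unit tangent_derivative tangent_derivative]
      assms curvature_pos[OF assms] by (simp add: inner_commute)
  moreover have "norm (principal_normal \<psi> s) = 1"
    using curvature_pos[OF assms] by (simp add: principal_normal_def curvature_def)
  ultimately show ?thesis
    using unit[OF assms] by (simp add: right_handed_frame_def binormal_def norm_eq_1)
qed

text \<open>Expand \<open>N'\<close> and \<open>B'\<close> in the frame. The coefficients follow from the constancy of the inner
  products, from \<open>T' = \<kappa> N\<close>, and from \<open>\<tau> = - B' \<bullet> N\<close>, the definition of the torsion.\<close>

lemma frenet_equations:
  assumes "s \<in> I"
  shows "(principal_normal \<psi> has_vector_derivative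
      - curvature \<psi> s *\<^sub>R tangent \<psi> s + torsion \<psi> s *\<^sub>R binormal \<psi> s) (at s)"
    and "(binormal \<psi> has_vector_derivative - torsion \<psi> s *\<^sub>R principal_normal \<psi> s) (at s)"
proof -
  let ?T = "tangent \<psi>" and ?N = "principal_normal \<psi>" and ?B = "binormal \<psi>"
  let ?\<kappa> = "curvature \<psi> s" and ?\<tau> = "torsion \<psi> s"
  have open_I: "open I"
    using curve by (auto simp: frenet_curve_def)
  note frame = right_handed_frame_inner[OF frenet_frame]
  define N' where "N' = vector_derivative ?N (at s)"
  define B' where "B' = vector_derivative ?B (at s)"
  have dT: "(?T has_vector_derivative ?\<kappa> *\<^sub>R ?N s) (at s)"
    using tangent_derivative[OF assms] .
  have dN: "(?N has_vector_derivative N') (at s)"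
    using principal_normal_differentiable[OF assms] by (simp add: N'_def vector_derivative_works)
  have "?B = (\<lambda>u. cross3 (?T u) (?N u))"
    by (auto simp: binormal_def)
  with has_vector_derivative_cross3[OF dT dN] have dB: "(?B has_vector_derivative B') (at s)"
    unfolding B'_def by (metis vector_derivative_at)
  note const = derivative_of_constant_inner[OF open_I assms]
  have "?N s \<bullet> N' = 0"
    using const[OF frame(2) dN dN] by (simp add: inner_commute)
  moreover have "?T s \<bullet> N' = - ?\<kappa>"
    using const[OF frame(4) dT dN] frame[OF assms] by (simp add: inner_commute)
  moreover have B'_N: "?N s \<bullet> B' = - ?\<tau>"
    by (simp add: torsion_def B'_def inner_commute)
  moreover have "?B s \<bullet> N' = ?\<tau>"
    using const[OF frame(9) dB dN] B'_N by (simp add: inner_commute)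
  ultimately have "N' = - ?\<kappa> *\<^sub>R ?T s + ?\<tau> *\<^sub>R ?B s"
    using frame_expansion[OF frenet_frame[OF assms], of N'] by simp
  with dN show "(?N has_vector_derivative - ?\<kappa> *\<^sub>R ?T s + ?\<tau> *\<^sub>R ?B s) (at s)"
    by simp
  have "?B s \<bullet> B' = 0"
    using const[OF frame(3) dB dB] by (simp add: inner_commute)
  moreover have "?T s \<bullet> B' = 0"
    using const[OF frame(5) dT dB] frame[OF assms] by (simp add: inner_commute)
  ultimately have "B' = - ?\<tau> *\<^sub>R ?N s"
    using frame_expansion[OF frenet_frame[OF assms], of B'] B'_N by simp
  with dB show "(?B has_vector_derivative - ?\<tau> *\<^sub>R ?N s) (at s)"
    by simp
qed

end

section \<open>Variable transformations\<close>

lemma variable_transformation_cong: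
  assumes "\<And>t. t \<in> J \<Longrightarrow> lam t = lam' t"
  shows "variable_transformation J I \<phi> lam \<longleftrightarrow> variable_transformation J I \<phi> lam'"
  using assms by (auto simp: variable_transformation_def)

lemma variable_transformation_inverse:
  assumes trans: "variable_transformation J I \<phi> lam" and "open J"
  shows "variable_transformation I J (inv_into J \<phi>) (\<lambda>s. 1 / lam (inv_into J \<phi> s))"
proof -
  let ?\<sigma> = "inv_into J \<phi>"
  have bij: "bij_betw \<phi> J I" and pos: "\<And>t. t \<in> J \<Longrightarrow> lam t > 0"
    and der: "\<And>t. t \<in> J \<Longrightarrow> (\<phi> has_real_derivative lam t) (at t)"
    using trans by (auto simp: variable_transformation_def)
  have "(?\<sigma> has_real_derivative 1 / lam t) (at (\<phi> t))" if "t \<in> J" for t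
    unfolding has_field_derivative_def
  proof (rule has_derivative_inverse_on[OF \<open>open J\<close> _ _ _ that])
    show "(\<phi> has_derivative (*) (lam x)) (at x)" if "x \<in> J" for x
      using der[OF that] by (simp add: has_field_derivative_def)
    show "?\<sigma> (\<phi> x) = x" if "x \<in> J" for x
      using bij that by (simp add: bij_betw_def)
    show "(*) (lam t) \<circ> (*) (1 / lam t) = id"
      using pos[OF that] by auto
  qed
  then have "(?\<sigma> has_real_derivative 1 / lam (?\<sigma> s)) (at s)" if "s \<in> I" for s
    using bij that by (metis bij_betw_def f_inv_into_f inv_into_into)
  moreover have "lam (?\<sigma> s) > 0" if "s \<in> I" for s
    using bij that pos by (metis bij_betw_def inv_into_into)
  ultimately show ?thesis
    using bij by (auto simp: variable_transformation_def bij_betw_inv_into)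
qed

text \<open>The base point of a total curvature may lie on either side of the parameter, so the
  substitution rule is needed for endpoints in either order.\<close>

lemma interval_integral_substitution_oriented:
  fixes a c :: real and f g g' :: "real \<Rightarrow> real"
  assumes I: "is_interval I" "a \<in> I" "c \<in> I"
    and der: "\<And>x. x \<in> I \<Longrightarrow> (g has_real_derivative g' x) (at x)"
    and f: "continuous_on (g ` I) f" and g': "continuous_on I g'"
  shows "(LBINT x=a..c. g' x * f (g x)) = (LBINT y=g a..g c. f y)"
proof -
  have forward: "(LBINT x=p..q. g' x * f (g x)) = (LBINT y=g p..g q. f y)"
    if "p \<le> q" "p \<in> I" "q \<in> I" for p q :: real
  proof -
    have sub: "{p..q} \<subseteq> I"
      using I(1) that unfolding is_interval_1 by (meson atLeastAtMost_iff subsetI)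
    have "(LBINT x=p..q. g' x *\<^sub>R f (g x)) = (LBINT y=g p..g q. f y)"
    proof (rule interval_integral_substitution_finite[OF \<open>p \<le> q\<close>])
      show "(g has_real_derivative g' x) (at x within {p..q})" if "p \<le> x" "x \<le> q" for x
        using that sub by (intro has_field_derivative_at_within[OF der]) auto
      show "continuous_on (g ` {p..q}) f"
        using f sub by (meson continuous_on_subset image_mono)
      show "continuous_on {p..q} g'"
        using g' sub by (rule continuous_on_subset)
    qed
    then show ?thesis by simp
  qed
  show ?thesis
  proof (cases "a \<le> c")
    case True
    then show ?thesis using forward I by simp
  next
    case False
    then have "(LBINT x=c..a. g' x * f (g x)) = (LBINT y=g c..g a. f y)"
      using forward I by simp
    then show ?thesis
      by (simp add: interval_integral_endpoints_reverse[of "ereal a"]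
          interval_integral_endpoints_reverse[of "ereal (g a)"])
  qed
qed

text \<open>Equality of total curvatures is the integrated form of \<open>\<sigma>' = \<kappa>\<^sub>\<alpha> / \<kappa>\<^sub>\<beta>\<close>, provided that the
  two base points correspond under \<open>\<sigma>\<close>.\<close>

lemma total_curvature_substitution:
  assumes \<alpha>: "frenet_curve I \<alpha>" and \<beta>: "frenet_curve J \<beta>"
    and trans: "variable_transformation I J \<sigma> (\<lambda>s. curvature \<alpha> s / curvature \<beta> (\<sigma> s))"
    and a: "a \<in> I" and s: "s \<in> I"
  shows "total_curvature \<beta> (\<sigma> a) (\<sigma> s) = total_curvature \<alpha> a s"
proof -
  let ?r = "\<lambda>s. curvature \<alpha> s / curvature \<beta> (\<sigma> s)"
  have interval: "is_interval I"
    using \<alpha> by (simp add: frenet_curve_def)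
  have img: "\<sigma> ` I = J"
    and der: "\<And>u. u \<in> I \<Longrightarrow> (\<sigma> has_real_derivative ?r u) (at u)"
    using trans by (auto simp: variable_transformation_def bij_betw_def)
  have nz: "curvature \<beta> (\<sigma> u) \<noteq> 0" if "u \<in> I" for u
    using curvature_pos[OF \<beta>, of "\<sigma> u"] img that by auto
  have "continuous_on I \<sigma>"
    using der by (meson DERIV_isCont continuous_at_imp_continuous_on)
  then have "continuous_on I (\<lambda>u. curvature \<beta> (\<sigma> u))"
    using curvature_continuous[OF \<beta>] img by (auto intro: continuous_on_compose2)
  then have cont_r: "continuous_on I ?r"
    using curvature_continuous[OF \<alpha>] nz by (intro continuous_on_divide) auto
  have "total_curvature \<beta> (\<sigma> a) (\<sigma> s) = (LBINT u=a..s. ?r u * curvature \<beta> (\<sigma> u))"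
    unfolding total_curvature_def
    using interval_integral_substitution_oriented[OF interval a s der _ cont_r, of "curvature \<beta>"]
      curvature_continuous[OF \<beta>] img by simp
  also have "\<dots> = total_curvature \<alpha> a s"
    unfolding total_curvature_def
  proof (rule interval_integral_cong)
    fix u assume "u \<in> einterval (min (ereal a) (ereal s)) (max (ereal a) (ereal s))"
    then have "a \<le> u \<and> u \<le> s \<or> s \<le> u \<and> u \<le> a"
      by (auto simp: einterval_def min_def max_def split: if_splits)
    then have "u \<in> I"
      using interval a s unfolding is_interval_1 by blast
    then show "?r u * curvature \<beta> (\<sigma> u) = curvature \<alpha> u"
      using nz by simp
  qed
  finally show ?thesis .
qed

section \<open>Equal tangents force equal ratios\<close>

lemma derivative_of_rotated_correspondence:
  fixes f g :: "real \<Rightarrow> real^3"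
  assumes "open J" "t \<in> J" "\<And>u. u \<in> J \<Longrightarrow> Q *v f u = g (\<phi> u)"
    and \<phi>: "(\<phi> has_real_derivative l) (at t)"
    and f: "(f has_vector_derivative f') (at t)"
    and g: "(g has_vector_derivative g') (at (\<phi> t))"
  shows "Q *v f' = l *\<^sub>R g'"
proof -
  have "((\<lambda>u. Q *v f u) has_vector_derivative Q *v f') (at t)"
    by (rule bounded_linear.has_vector_derivative[OF matrix_vector_mul_bounded_linear f])
  moreover have "((g \<circ> \<phi>) has_vector_derivative l *\<^sub>R g') (at t)"
    using \<phi> g by (simp add: has_real_derivative_iff_has_vector_derivative vector_diff_chain_at)
  then have "((\<lambda>u. Q *v f u) has_vector_derivative l *\<^sub>R g') (at t)"
    by (rule has_vector_derivative_transform_within_open[OF _ assms(1,2)]) (simp add: assms(3))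
  ultimately show ?thesis
    by (rule vector_derivative_unique_at)
qed

text \<open>The correspondence propagates from \<open>T\<close> to \<open>N\<close> by differentiation and to \<open>B\<close> by the cross
  product. Positivity of \<open>lam\<close> excludes \<open>Q N\<^sub>\<beta> = - N\<^sub>\<alpha>\<close>.\<close>

lemma frenet_apparatus_of_equal_tangents:
  assumes \<alpha>: "frenet_curve I \<alpha>" and \<beta>: "frenet_curve J \<beta>"
    and trans: "variable_transformation J I \<phi> lam"
    and Q: "rotation_matrix Q"
    and tangents: "\<And>t. t \<in> J \<Longrightarrow> Q *v tangent \<beta> t = tangent \<alpha> (\<phi> t)"
    and t: "t \<in> J"
  shows "curvature \<beta> t = lam t * curvature \<alpha> (\<phi> t)"
    and "torsion \<beta> t = lam t * torsion \<alpha> (\<phi> t)"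
proof -
  have open_J: "open J"
    using \<beta> by (simp add: frenet_curve_def)
  have in_I: "\<phi> u \<in> I" and pos: "lam u > 0" and der: "(\<phi> has_real_derivative lam u) (at u)"
    if "u \<in> J" for u
    using trans that by (auto simp: variable_transformation_def bij_betw_def)
  note correspond = derivative_of_rotated_correspondence[OF open_J]
  have T': "curvature \<beta> u *\<^sub>R (Q *v principal_normal \<beta> u) =
      (lam u * curvature \<alpha> (\<phi> u)) *\<^sub>R principal_normal \<alpha> (\<phi> u)" if u: "u \<in> J" for u
    using correspond[OF u tangents der[OF u] tangent_derivative[OF \<beta> u]
        tangent_derivative[OF \<alpha> in_I[OF u]]]
    by (simp add: matrix_vector_mult_scaleR)
  have unit: "norm (Q *v principal_normal \<beta> u) = 1" "norm (principal_normal \<alpha> (\<phi> u)) = 1"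
    if u: "u \<in> J" for u
    using right_handed_frame_inner(2)[OF frenet_frame[OF \<beta> u]]
      right_handed_frame_inner(2)[OF frenet_frame[OF \<alpha> in_I[OF u]]]
    by (simp_all add: rotation_matrix_norm[OF Q] norm_eq_1)
  have curv: "curvature \<beta> u = lam u * curvature \<alpha> (\<phi> u)" if u: "u \<in> J" for u
    using arg_cong[OF T'[OF u], of norm] curvature_pos[OF \<beta> u] curvature_pos[OF \<alpha> in_I[OF u]]
      pos[OF u] unit[OF u] by simp
  then show "curvature \<beta> t = lam t * curvature \<alpha> (\<phi> t)"
    using t .
  have normals: "Q *v principal_normal \<beta> u = principal_normal \<alpha> (\<phi> u)" if u: "u \<in> J" for u
    using T'[OF u] curvature_pos[OF \<beta> u] unfolding curv[OF u, symmetric] by simp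
  have binormals: "Q *v binormal \<beta> u = binormal \<alpha> (\<phi> u)" if u: "u \<in> J" for u
    using tangents[OF u] normals[OF u]
    by (simp add: binormal_def cross_rotation_matrix[OF Q, symmetric])
  have "- torsion \<beta> t *\<^sub>R (Q *v principal_normal \<beta> t) =
      - (lam t * torsion \<alpha> (\<phi> t)) *\<^sub>R principal_normal \<alpha> (\<phi> t)"
    using correspond[OF t binormals der[OF t] frenet_equations(2)[OF \<beta> t]
        frenet_equations(2)[OF \<alpha> in_I[OF t]]]
    by (simp add: matrix_vector_mult_scaleR del: scaleR_minus_left)
  then show "torsion \<beta> t = lam t * torsion \<alpha> (\<phi> t)"
    using normals[OF t] unit[OF t] by auto
qed

lemma equal_ratio_of_equal_tangents:
  assumes \<alpha>: "frenet_curve I \<alpha>" and \<beta>: "frenet_curve J \<beta>"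
    and trans: "variable_transformation J I \<phi> lam"
    and Q: "rotation_matrix Q"
    and tangents: "\<And>t. t \<in> J \<Longrightarrow> Q *v tangent \<beta> t = tangent \<alpha> (\<phi> t)"
  shows "equal_ratio_under_equal_total_curvature I \<alpha> J \<beta>"
proof -
  let ?\<sigma> = "inv_into J \<phi>"
  have bij: "bij_betw \<phi> J I" and pos: "\<And>t. t \<in> J \<Longrightarrow> lam t > 0"
    using trans by (auto simp: variable_transformation_def)
  have \<sigma>: "?\<sigma> s \<in> J" "\<phi> (?\<sigma> s) = s" if "s \<in> I" for s
    using bij that by (auto simp: bij_betw_def inv_into_into f_inv_into_f)
  note app = frenet_apparatus_of_equal_tangents[OF \<alpha> \<beta> trans Q tangents \<sigma>(1)]
  have inverse: "variable_transformation I J ?\<sigma> (\<lambda>s. 1 / lam (?\<sigma> s))"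
    using variable_transformation_inverse[OF trans] \<beta> by (simp add: frenet_curve_def)
  have "1 / lam (?\<sigma> s) = curvature \<alpha> s / curvature \<beta> (?\<sigma> s)" if "s \<in> I" for s
    using app(1)[OF _ that] \<sigma>(2)[OF that] curvature_pos[OF \<alpha> that] by simp
  from variable_transformation_cong[OF this] inverse have trans':
    "variable_transformation I J ?\<sigma> (\<lambda>s. curvature \<alpha> s / curvature \<beta> (?\<sigma> s))"
    by (rule iffD1)
  obtain a where a: "a \<in> I"
    using \<alpha> by (auto simp: frenet_curve_def)
  have ratio: "torsion \<beta> (?\<sigma> s) / curvature \<beta> (?\<sigma> s) = torsion \<alpha> s / curvature \<alpha> s"
    if "s \<in> I" for s
    using app[OF _ that] \<sigma>[OF that] pos[OF \<sigma>(1)[OF that]] by simp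
  have total: "\<forall>s\<in>I. total_curvature \<beta> (?\<sigma> a) (?\<sigma> s) = total_curvature \<alpha> a s"
    using total_curvature_substitution[OF \<alpha> \<beta> trans' a] by (rule ballI)
  show ?thesis
    unfolding equal_ratio_under_equal_total_curvature_def
  proof (intro exI conjI)
    show "variable_transformation I J ?\<sigma> (\<lambda>s. curvature \<alpha> s / curvature \<beta> (?\<sigma> s))"
      by (rule trans')
    show "\<exists>a\<in>I. \<exists>b\<in>J. \<forall>s\<in>I.
        total_curvature \<beta> b (?\<sigma> s) = total_curvature \<alpha> a s"
      by (rule bexI[of _ a], rule bexI[of _ "?\<sigma> a"]) (fact total, fact \<sigma>(1)[OF a], fact a)
    show "\<forall>s\<in>I. torsion \<beta> (?\<sigma> s) / curvature \<beta> (?\<sigma> s) = torsion \<alpha> s / curvature \<alpha> s"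
      by (rule ballI) (rule ratio)
  qed
qed

section \<open>Equal ratios force equal tangents up to a rotation\<close>

text \<open>A parameter of speed \<open>k / \<kappa>\<^sub>\<beta>\<close> brings the Frenet system into a form that depends on the curve
  only through \<open>\<rho> = \<tau>\<^sub>\<beta> / \<kappa>\<^sub>\<beta>\<close>. With \<open>\<sigma>\<close> the identity and \<open>k\<close> the curvature it also covers
  the original arclength parameter, so that the systems of two curves can be compared.\<close>

lemma frenet_equations_reparametrized:
  assumes \<beta>: "frenet_curve J \<beta>" and s: "\<sigma> s \<in> J"
    and \<sigma>: "(\<sigma> has_real_derivative k / curvature \<beta> (\<sigma> s)) (at s)"
    and ratio: "torsion \<beta> (\<sigma> s) / curvature \<beta> (\<sigma> s) = \<rho>"
  shows "((\<lambda>u. tangent \<beta> (\<sigma> u)) has_vector_derivative k *\<^sub>R principal_normal \<beta> (\<sigma> s)) (at s)"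
    and "((\<lambda>u. principal_normal \<beta> (\<sigma> u)) has_vector_derivative
      k *\<^sub>R (- tangent \<beta> (\<sigma> s) + \<rho> *\<^sub>R binormal \<beta> (\<sigma> s))) (at s)"
    and "((\<lambda>u. binormal \<beta> (\<sigma> u)) has_vector_derivative
      k *\<^sub>R (- \<rho> *\<^sub>R principal_normal \<beta> (\<sigma> s))) (at s)"
proof -
  have \<kappa>: "curvature \<beta> (\<sigma> s) \<noteq> 0"
    using curvature_pos[OF \<beta> s] by simp
  have \<tau>: "torsion \<beta> (\<sigma> s) = \<rho> * curvature \<beta> (\<sigma> s)"
    using ratio \<kappa> by auto
  note chain = vector_diff_chain_at[OF \<sigma>[unfolded has_real_derivative_iff_has_vector_derivative]]
  show "((\<lambda>u. tangent \<beta> (\<sigma> u)) has_vector_derivative k *\<^sub>R principal_normal \<beta> (\<sigma> s)) (at s)"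
    using chain[OF tangent_derivative[OF \<beta> s]] \<kappa> by (simp add: o_def)
  show "((\<lambda>u. principal_normal \<beta> (\<sigma> u)) has_vector_derivative
      k *\<^sub>R (- tangent \<beta> (\<sigma> s) + \<rho> *\<^sub>R binormal \<beta> (\<sigma> s))) (at s)"
    using chain[OF frenet_equations(1)[OF \<beta> s]] \<kappa>
    by (simp add: o_def \<tau> scaleR_right_distrib scaleR_right_diff_distrib mult.commute)
  show "((\<lambda>u. binormal \<beta> (\<sigma> u)) has_vector_derivative
      k *\<^sub>R (- \<rho> *\<^sub>R principal_normal \<beta> (\<sigma> s))) (at s)"
    using chain[OF frenet_equations(2)[OF \<beta> s]] \<kappa> by (simp add: o_def \<tau>)
qed

text \<open>The derivative of \<open>M v = (T\<^sub>\<beta> \<bullet> v) T\<^sub>\<alpha> + (N\<^sub>\<beta> \<bullet> v) N\<^sub>\<alpha> + (B\<^sub>\<beta> \<bullet> v) B\<^sub>\<alpha>\<close> vanishes for every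
  fixed \<open>v\<close>: both frames have the same skew coefficient matrix, and the terms cancel in pairs.\<close>

lemma rotation_of_equal_ratio:
  assumes \<alpha>: "frenet_curve I \<alpha>" and \<beta>: "frenet_curve J \<beta>"
    and trans: "variable_transformation I J \<sigma> (\<lambda>s. curvature \<alpha> s / curvature \<beta> (\<sigma> s))"
    and ratio: "\<And>s. s \<in> I \<Longrightarrow>
      torsion \<beta> (\<sigma> s) / curvature \<beta> (\<sigma> s) = torsion \<alpha> s / curvature \<alpha> s"
  obtains Q where "rotation_matrix Q" "\<And>s. s \<in> I \<Longrightarrow> Q *v tangent \<beta> (\<sigma> s) = tangent \<alpha> s"
proof -
  define P where "P \<psi> s = (vector [tangent \<psi> s, principal_normal \<psi> s, binormal \<psi> s] :: real^3^3)"
    for \<psi> s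
  define M where "M s = transpose (P \<alpha> s) ** P \<beta> (\<sigma> s)" for s
  have \<sigma>_in: "\<sigma> s \<in> J" if "s \<in> I" for s
    using trans that by (auto simp: variable_transformation_def bij_betw_def)
  have M_apply: "M s *v v = (tangent \<beta> (\<sigma> s) \<bullet> v) *\<^sub>R tangent \<alpha> s +
      (principal_normal \<beta> (\<sigma> s) \<bullet> v) *\<^sub>R principal_normal \<alpha> s +
      (binormal \<beta> (\<sigma> s) \<bullet> v) *\<^sub>R binormal \<alpha> s" for s v
    by (simp add: M_def P_def frame_to_frame_matrix_vector_mult)
  have rot: "rotation_matrix (M s)" if "s \<in> I" for s
    unfolding M_def P_def using that \<sigma>_in
    by (intro rotation_matrix_transpose_mult rotation_matrix_frame frenet_frame[OF \<alpha>]
        frenet_frame[OF \<beta>]) auto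
  have M_tangent: "M s *v tangent \<beta> (\<sigma> s) = tangent \<alpha> s" if "s \<in> I" for s
    by (simp add: M_apply right_handed_frame_inner[OF frenet_frame[OF \<beta> \<sigma>_in[OF that]]])
  have der_M: "((\<lambda>u. M u *v v) has_vector_derivative 0) (at s)" if s: "s \<in> I" for s v
  proof -
    let ?k = "curvature \<alpha> s" and ?\<rho> = "torsion \<alpha> s / curvature \<alpha> s"
    have \<sigma>_der: "(\<sigma> has_real_derivative ?k / curvature \<beta> (\<sigma> s)) (at s)"
      using trans s by (simp add: variable_transformation_def)
    have id_der: "((\<lambda>u. u) has_real_derivative ?k / curvature \<alpha> s) (at s)"
      using curvature_pos[OF \<alpha> s] by simp
    \<comment> \<open>\<open>\<alpha>\<close> in its own arclength, and \<open>\<beta>\<close> through \<open>\<sigma>\<close>, with the same \<open>k\<close> and \<open>\<rho>\<close>.\<close>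
    note A = frenet_equations_reparametrized[where \<sigma> = "\<lambda>u. u", OF \<alpha> s id_der refl]
    note C = frenet_equations_reparametrized[OF \<beta> \<sigma>_in[OF s] \<sigma>_der ratio[OF s]]
    have inner_der: "((\<lambda>u. f u \<bullet> v) has_real_derivative f' \<bullet> v) (at s)"
      if "(f has_vector_derivative f') (at s)" for f f'
      using has_vector_derivative_inner[OF that has_vector_derivative_const[of v]] by simp
    note summand = has_vector_derivative_scaleR[OF inner_der]
    show ?thesis
      unfolding M_apply
      by (rule has_vector_derivative_eq_rhs[OF has_vector_derivative_add[OF
            has_vector_derivative_add[OF summand[OF C(1) A(1)] summand[OF C(2) A(2)]]
            summand[OF C(3) A(3)]]])
         (simp add: algebra_simps)
  qed
  obtain a where a: "a \<in> I"
    using \<alpha> by (auto simp: frenet_curve_def)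
  have const: "M s *v v = M a *v v" if s: "s \<in> I" for s v
  proof -
    have "convex I"
      using \<alpha> by (simp add: frenet_curve_def is_interval_convex)
    then obtain c where "\<And>u. u \<in> I \<Longrightarrow> M u *v v = c"
      using has_vector_derivative_zero_constant[of I "\<lambda>u. M u *v v"] der_M
      by (metis has_vector_derivative_at_within)
    then show ?thesis using a s by simp
  qed
  show thesis
  proof
    show "rotation_matrix (M a)"
      using rot[OF a] .
    show "M a *v tangent \<beta> (\<sigma> s) = tangent \<alpha> s" if "s \<in> I" for s
      using const[OF that] M_tangent[OF that] by simp
  qed
qed

lemma tangent_rigid_motion:
  assumes "\<psi> differentiable (at t)"
  shows "tangent ((\<lambda>x. Q *v x + c) \<circ> \<psi>) t = Q *v tangent \<psi> t"
proof -
  have "((\<lambda>u. Q *v \<psi> u) has_vector_derivative Q *v tangent \<psi> t) (at t)"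
    using assms bounded_linear.has_vector_derivative[OF matrix_vector_mul_bounded_linear]
    by (simp add: tangent_def vector_derivative_works)
  from has_vector_derivative_add[OF this has_vector_derivative_const[of c]] show ?thesis
    unfolding tangent_def by (simp add: o_def vector_derivative_at)
qed

theorem theorem4p5:
  fixes I J :: "real set" and \<alpha> \<beta> :: "real \<Rightarrow> real^3"
  assumes "frenet_curve I \<alpha>" and "frenet_curve J \<beta>"
  shows "(similar_curves I \<alpha> J \<beta> \<longrightarrow> equal_ratio_under_equal_total_curvature I \<alpha> J \<beta>) \<and>
    ((\<exists>g. rigid_motion g \<and> similar_curves I \<alpha> J (g \<circ> \<beta>)) \<longleftrightarrow>
       equal_ratio_under_equal_total_curvature I \<alpha> J \<beta>)"
proof -
  let ?similar = "\<exists>g. rigid_motion g \<and> similar_curves I \<alpha> J (g \<circ> \<beta>)"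
  let ?ratio = "equal_ratio_under_equal_total_curvature I \<alpha> J \<beta>"
  have \<beta>_diff: "\<beta> differentiable (at t)" if "t \<in> J" for t
    using assms(2) that by (simp add: frenet_curve_def)
  have "?similar" if "similar_curves I \<alpha> J \<beta>"
  proof -
    have "rotation_matrix (mat 1 :: real^3^3)"
      by (simp add: rotation_matrix_def orthogonal_matrix_id)
    then have "rigid_motion id"
      unfolding rigid_motion_def by (intro exI[of _ "mat 1"] exI[of _ 0]) auto
    then show ?thesis
      using that by (metis id_comp)
  qed
  moreover have "?ratio" if "?similar"
  proof -
    from that obtain Q c \<phi> lam where Q: "rotation_matrix Q"
      and trans: "variable_transformation J I \<phi> lam"
      and "\<forall>t\<in>J. tangent ((\<lambda>x. Q *v x + c) \<circ> \<beta>) t = tangent \<alpha> (\<phi> t)"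
      unfolding rigid_motion_def similar_curves_def similar_curves_with_def by blast
    then have "Q *v tangent \<beta> t = tangent \<alpha> (\<phi> t)" if "t \<in> J" for t
      using tangent_rigid_motion[OF \<beta>_diff[OF that]] that by metis
    then show ?thesis
      by (rule equal_ratio_of_equal_tangents[OF assms trans Q])
  qed
  moreover have "?similar" if "?ratio"
  proof -
    from that obtain \<sigma>
      where trans: "variable_transformation I J \<sigma> (\<lambda>s. curvature \<alpha> s / curvature \<beta> (\<sigma> s))"
      and "\<And>s. s \<in> I \<Longrightarrow>
        torsion \<beta> (\<sigma> s) / curvature \<beta> (\<sigma> s) = torsion \<alpha> s / curvature \<alpha> s"
      unfolding equal_ratio_under_equal_total_curvature_def by blast
    from rotation_of_equal_ratio[OF assms this] obtain Q
      where Q: "rotation_matrix Q"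
      and tangents: "\<And>s. s \<in> I \<Longrightarrow> Q *v tangent \<beta> (\<sigma> s) = tangent \<alpha> s"
      by blast
    let ?\<phi> = "inv_into I \<sigma>" and ?g = "\<lambda>x. Q *v x + 0"
    have bij: "bij_betw \<sigma> I J" and "open I"
      using trans assms(1) by (auto simp: variable_transformation_def frenet_curve_def)
    have "tangent (?g \<circ> \<beta>) t = tangent \<alpha> (?\<phi> t)" if "t \<in> J" for t
    proof -
      have "?\<phi> t \<in> I" "\<sigma> (?\<phi> t) = t"
        using bij that by (auto simp: bij_betw_def inv_into_into f_inv_into_f)
      then show ?thesis
        using tangents[of "?\<phi> t"] tangent_rigid_motion[OF \<beta>_diff[OF that], of Q 0] by simp
    qed
    then have "similar_curves I \<alpha> J (?g \<circ> \<beta>)"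
      unfolding similar_curves_def similar_curves_with_def
      using variable_transformation_inverse[OF trans \<open>open I\<close>] by blast
    moreover have "rigid_motion ?g"
      unfolding rigid_motion_def using Q by blast
    ultimately show ?thesis by blast
  qed
  ultimately show ?thesis by blast
qed

end
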